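(* Suppose one observes a time-labelled BCMRT of size $2n$, and let $\mathbf R^\star_{q_0,q_1}$ (which depends on $n$) denote the optimal risk for testing $H_0: q=q_0$ against $H_1:q=q_1$ from this observation. Then the following hold. (i) If $(q_0^{(n)})_n$ and $(q_1^{(n)})_n$ are sequences with $0\le q_0^{(n)}<q_1^{(n)}\le 1/2$ and $$\left(q_1^{(n)}-q_0^{(n)}\right)^2\left(1-q_0^{(n)}-q_1^{(n)}\right)^2\gg\frac{q_1^{(n)}}{\log n},$$ then $\mathbf R^\star_{q_0^{(n)},q_1^{(n)}}\to0$ as $n\to\infty$. In particular, if $q_1^{(n)}=1/2$ and $\frac12-q_0^{(n)}\gg\frac{1}{(\log n)^{1/4}}$, then $\mathbf R^\star_{q_0^{(n)},1/2}\to0$ as $n\to\infty$. (ii) If $(q_0^{(n)})_n$ is a sequence in $[0,1/2)$ with $\frac12-q_0^{(n)}\ll\frac1{\sqrt n}$, then $\mathbf R^\star_{q_0^{(n)},1/2}\to\frac12$ as $n\to\infty$.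
   Context: BCMRT$(q)$ (balanced community modulated random recursive tree), $q\in[0,1]$: $T_1$ is a single edge (the root edge) joining two nodes with time-label $1$, one of type $A$, denoted $(1,A)$, and one of type $B$, denoted $(1,B)$. At each step $n\ge 2$, two new nodes with time-label $n$, namely $(n,A)$ of type $A$ and $(n,B)$ of type $B$, are added to the tree $T_{n-1}$ of size $2(n-1)$: (1) the two nodes independently (of each other and of the past) decide to connect to a node of their own type with probability $1-q$, or to a node of the other type with probability $q$; (2) each then independently chooses its parent uniformly among the $n-1$ nodes of $T_{n-1}$ of the selected type and is joined to it by an edge. This yields the tree $T_n$ of size $2n$. The time-labelled BCMRT of size $2n$ is the tree $T_n$ in which each node carries its time-label in $\{1,\dots,n\}$ (each label appears exactly twice) but types are hidden; i.e. it is $T_n$ considered up to label-preserving tree isomorphism. A test $\varphi$ is a function from the set of time-labelled trees that can occur as realisations of BCMRT of size $2n$ to $\{0,1\}$. Writing $\mathbf P_q$ for the law of the tree under BCMRT$(q)$, the risk of $\varphi$ is $\mathbf R_{q_0,q_1}(\varphi)=\frac12\left(\mathbf P_{q_0}(\varphi=1)+\mathbf P_{q_1}(\varphi=0)\right)$ and $\mathbf R^\star_{q_0,q_1}=\inf_\varphi\mathbf R_{q_0,q_1}(\varphi)$, the infimum being over all tests. The parameters may depend on the total size of the tree (through $n$) but are constant during the growth of a given tree. Notation: $a_n\gg b_n$ means $a_n/b_n\to+\infty$ and $a_n\ll b_n$ means $a_n/b_n\to0$ as $n\to\infty$. *)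

theory Defs
  imports "HOL-Probability.Probability" "HOL-Library.Monad_Syntax"
begin

datatype community = Com_A | Com_B

fun opposite :: "community \<Rightarrow> community" where
  "opposite Com_A = Com_B"
| "opposite Com_B = Com_A"

text \<open>
  The node \<open>(k, t)\<close> has time-label \<open>k\<close> and type \<open>t\<close>. A tree of size \<open>2n\<close> has node set
  \<open>nodes n\<close> and is identified with its set of (unordered) edges.
\<close>

type_synonym node = "nat \<times> community"
type_synonym tree = "node set set"

definition nodes :: "nat \<Rightarrow> node set" where
  "nodes n = {1..n} \<times> UNIV"

definition parent_pmf :: "real \<Rightarrow> nat \<Rightarrow> community \<Rightarrow> node pmf" where
  "parent_pmf q m t = do {
     switch \<leftarrow> bernoulli_pmf q;
     pmf_of_set ({1..m} \<times> {if switch then opposite t else t})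
   }"

text \<open>The process starts at \<open>n = 1\<close>; the value at \<open>0\<close> is a dummy.\<close>

fun bcmrt :: "real \<Rightarrow> nat \<Rightarrow> tree pmf" where
  "bcmrt q 0 = return_pmf {}"
| "bcmrt q (Suc 0) = return_pmf {{(1, Com_A), (1, Com_B)}}"
| "bcmrt q (Suc (Suc m)) = do {
     T \<leftarrow> bcmrt q (Suc m);
     a \<leftarrow> parent_pmf q (Suc m) Com_A;
     b \<leftarrow> parent_pmf q (Suc m) Com_B;
     return_pmf (T \<union> {{(Suc (Suc m), Com_A), a}, {(Suc (Suc m), Com_B), b}})
   }"

text \<open>
  Isomorphism of graphs on \<open>nodes n\<close> preserving time-labels, but not necessarily types.
\<close>

definition label_iso :: "nat \<Rightarrow> (tree \<times> tree) set" where
  "label_iso n = {(S, T). S \<subseteq> Pow (nodes n) \<and> T \<subseteq> Pow (nodes n) \<and>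
     (\<exists>f. bij_betw f (nodes n) (nodes n) \<and> (\<forall>v\<in>nodes n. fst (f v) = fst v) \<and> (`) f ` S = T)}"

lemma equiv_label_iso: "equiv (Pow (Pow (nodes n))) (label_iso n)"
proof (rule equivI)
  show "label_iso n \<subseteq> Pow (Pow (nodes n)) \<times> Pow (Pow (nodes n))"
    by (auto simp: label_iso_def)
  show "refl_on (Pow (Pow (nodes n))) (label_iso n)"
  proof (rule refl_onI)
    fix S assume "S \<in> Pow (Pow (nodes n))"
    moreover have "bij_betw id (nodes n) (nodes n)" "(`) id ` S = S" by auto
    ultimately show "(S, S) \<in> label_iso n"
      unfolding label_iso_def by (auto intro!: exI[of _ id])
  qed
  show "sym (label_iso n)"
  proof (rule symI)
    fix S T assume "(S, T) \<in> label_iso n"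
    then obtain f where f: "S \<subseteq> Pow (nodes n)" "T \<subseteq> Pow (nodes n)"
      "bij_betw f (nodes n) (nodes n)" "\<forall>v\<in>nodes n. fst (f v) = fst v" "(`) f ` S = T"
      by (auto simp: label_iso_def)
    define g where "g = inv_into (nodes n) f"
    have g: "bij_betw g (nodes n) (nodes n)"
      unfolding g_def by (rule bij_betw_inv_into[OF f(3)])
    have "\<forall>v\<in>nodes n. fst (g v) = fst v"
      using f(3,4) g unfolding g_def
      by (metis bij_betw_apply bij_betw_inv_into_right)
    moreover have "g ` f ` e = e" if "e \<in> S" for e
      using that f(1,3) unfolding g_def
      by (intro inv_into_image_cancel) (auto simp: bij_betw_def)
    then have "(`) g ` T = S"
      unfolding f(5)[symmetric] by (simp add: image_comp)
    ultimately show "(T, S) \<in> label_iso n"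
      using f(1,2) g unfolding label_iso_def by auto
  qed
  show "trans (label_iso n)"
  proof (rule transI)
    fix S T U assume "(S, T) \<in> label_iso n" "(T, U) \<in> label_iso n"
    then obtain f g where f: "S \<subseteq> Pow (nodes n)"
        "bij_betw f (nodes n) (nodes n)" "\<forall>v\<in>nodes n. fst (f v) = fst v" "(`) f ` S = T"
      and g: "U \<subseteq> Pow (nodes n)"
        "bij_betw g (nodes n) (nodes n)" "\<forall>v\<in>nodes n. fst (g v) = fst v" "(`) g ` T = U"
      by (auto simp: label_iso_def)
    have "bij_betw (g \<circ> f) (nodes n) (nodes n)"
      using f(2) g(2) by (rule bij_betw_trans)
    moreover have "\<forall>v\<in>nodes n. fst ((g \<circ> f) v) = fst v"
      using f(2,3) g(3) by (auto simp: bij_betw_apply)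
    moreover have "(`) (g \<circ> f) ` S = U"
      using f(4) g(4) by (auto simp: image_comp)
    ultimately show "(S, U) \<in> label_iso n"
      using f(1) g(1) unfolding label_iso_def by blast
  qed
qed

definition time_labelled_bcmrt :: "real \<Rightarrow> nat \<Rightarrow> tree set pmf" where
  "time_labelled_bcmrt q n = map_pmf (\<lambda>T. label_iso n `` {T}) (bcmrt q n)"

definition time_labelled_trees :: "nat \<Rightarrow> tree set set" where
  "time_labelled_trees n = (\<Union>q\<in>{0..1}. set_pmf (time_labelled_bcmrt q n))"

definition tests :: "nat \<Rightarrow> (tree set \<Rightarrow> nat) set" where
  "tests n = time_labelled_trees n \<rightarrow>\<^sub>E {0, 1}"

definition risk :: "nat \<Rightarrow> real \<Rightarrow> real \<Rightarrow> (tree set \<Rightarrow> nat) \<Rightarrow> real" where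
  "risk n q\<^sub>0 q\<^sub>1 \<phi> =
     1/2 * (measure_pmf.prob (time_labelled_bcmrt q\<^sub>0 n) {\<tau>. \<phi> \<tau> = 1} +
            measure_pmf.prob (time_labelled_bcmrt q\<^sub>1 n) {\<tau>. \<phi> \<tau> = 0})"

definition optimal_risk :: "nat \<Rightarrow> real \<Rightarrow> real \<Rightarrow> real" where
  "optimal_risk n q\<^sub>0 q\<^sub>1 = (INF \<phi>\<in>tests n. risk n q\<^sub>0 q\<^sub>1 \<phi>)"

end

theory Submission
  imports Defs
begin

text \<open>
  Write \<open>N\<close> for the number of labels \<open>k\<close> whose two nodes have the same parent. It is
  invariant under label-preserving isomorphism. The two parents of step \<open>k\<close> have the same type
  with probability \<open>2 q (1 - q)\<close> and then coincide with probability \<open>1 / (k - 1)\<close>, so \<open>N\<close> is a sum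
  of independent indicators with mean \<open>2 q (1 - q) H\<^sub>n\<^sub>-\<^sub>1\<close> and variance at most its mean. As
  \<open>r (1 - r) - q (1 - q) = (r - q) (1 - q - r)\<close>, Chebyshev's inequality shows that thresholding
  \<open>N\<close> halfway between the two means separates the hypotheses in the first regime.

  In the second regime even the typed tree carries no information: it is an image of \<open>2 (n - 1)\<close>
  Bernoulli switches and of choices whose law does not depend on \<open>q\<close>, and replacing one switch by a
  fair coin costs a factor \<open>1 + 4 (1/2 - q)\<^sup>2\<close> in \<open>1 + \<chi>\<^sup>2\<close>. The product of these factors tends
  to \<open>1\<close> when \<open>n (1/2 - q)\<^sup>2 \<rightarrow> 0\<close>, which bounds the total variation distance.
\<close>

section \<open>Expectations under finitely supported distributions\<close>

lemma expectation_bind_finite: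
  fixes h :: "'b \<Rightarrow> real"
  assumes "finite (set_pmf p)" "\<And>x. x \<in> set_pmf p \<Longrightarrow> finite (set_pmf (K x))"
  shows "measure_pmf.expectation (p \<bind> K) h
       = measure_pmf.expectation p (\<lambda>x. measure_pmf.expectation (K x) h)"
proof -
  have "measure_pmf.expectation (p \<bind> K) h
      = (\<Sum>x\<in>set_pmf p. pmf p x *\<^sub>R measure_pmf.expectation (K x) h)"
    using assms by (intro pmf_expectation_bind) auto
  also have "\<dots> = measure_pmf.expectation p (\<lambda>x. measure_pmf.expectation (K x) h)"
    using assms(1) by (subst integral_measure_pmf[of "set_pmf p"]) auto
  finally show ?thesis .
qed

lemma expectation_cong_set_pmf:
  fixes f g :: "'a \<Rightarrow> real"
  assumes "\<And>x. x \<in> set_pmf p \<Longrightarrow> f x = g x"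
  shows "measure_pmf.expectation p f = measure_pmf.expectation p g"
  using assms by (intro integral_cong_AE) (auto simp: AE_measure_pmf_iff)

lemma expectation_mono_finite:
  fixes f g :: "'a \<Rightarrow> real"
  assumes "finite (set_pmf p)" "\<And>x. x \<in> set_pmf p \<Longrightarrow> f x \<le> g x"
  shows "measure_pmf.expectation p f \<le> measure_pmf.expectation p g"
  using assms by (intro integral_mono_AE integrable_measure_pmf_finite) (auto simp: AE_measure_pmf_iff)

lemma prob_le_expectation:
  fixes g :: "'a \<Rightarrow> real"
  assumes "finite (set_pmf p)" "\<And>x. x \<in> set_pmf p \<Longrightarrow> 0 \<le> g x"
    "\<And>x. x \<in> set_pmf p \<Longrightarrow> x \<in> E \<Longrightarrow> 1 \<le> g x"
  shows "measure_pmf.prob p E \<le> measure_pmf.expectation p g"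
proof -
  have "measure_pmf.expectation p (indicator E) \<le> measure_pmf.expectation p g"
    using assms by (intro expectation_mono_finite) (auto simp: indicator_def)
  then show ?thesis by simp
qed

section \<open>The chi-square bound in dual form\<close>

text \<open>
  For \<open>r\<close> dominating \<open>p\<close>, the least such \<open>C\<close> is \<open>1 + \<chi>\<^sup>2(p, r)\<close>. In this form the
  bound composes along \<open>\<bind>\<close> without mentioning densities.
\<close>

definition chi_bound :: "real \<Rightarrow> 'a pmf \<Rightarrow> 'a pmf \<Rightarrow> bool" where
  "chi_bound C p r \<longleftrightarrow>
     (\<forall>f. (measure_pmf.expectation p f)\<^sup>2 \<le> C * measure_pmf.expectation r (\<lambda>x. (f x)\<^sup>2))"

text \<open>Nonnegativity of the variance. It covers the random choices whose law does not depend on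
  \<open>q\<close>.\<close>

lemma chi_bound_refl:
  assumes "finite (set_pmf p)"
  shows "chi_bound 1 p p"
  unfolding chi_bound_def
proof
  fix f :: "'a \<Rightarrow> real"
  let ?e = "measure_pmf.expectation p f"
  note [simp] = integrable_measure_pmf_finite[OF assms]
  have "0 \<le> measure_pmf.expectation p (\<lambda>x. (f x - ?e)\<^sup>2)" by simp
  also have "\<dots> = measure_pmf.expectation p (\<lambda>x. (f x)\<^sup>2 - 2 * ?e * f x + ?e\<^sup>2)"
    by (simp add: power2_diff algebra_simps)
  also have "\<dots> = measure_pmf.expectation p (\<lambda>x. (f x)\<^sup>2) - ?e\<^sup>2"
    by (simp add: power2_eq_square)
  finally show "?e\<^sup>2 \<le> 1 * measure_pmf.expectation p (\<lambda>x. (f x)\<^sup>2)" by simp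
qed

text \<open>The first bound is applied to the function sending \<open>x\<close> to the mean of
  \<open>f\<close> under \<open>K x\<close>, the second to \<open>f\<close> itself, pointwise in
  \<open>x\<close>.\<close>

lemma chi_bound_bind:
  assumes "chi_bound C p r" "\<And>x. x \<in> set_pmf r \<Longrightarrow> chi_bound D (K x) (L x)"
    and "0 \<le> C" "set_pmf p \<subseteq> set_pmf r" "finite (set_pmf r)"
    and "\<And>x. x \<in> set_pmf r \<Longrightarrow> finite (set_pmf (K x))"
    and "\<And>x. x \<in> set_pmf r \<Longrightarrow> finite (set_pmf (L x))"
  shows "chi_bound (C * D) (p \<bind> K) (r \<bind> L)"
  unfolding chi_bound_def
proof
  fix f :: "'b \<Rightarrow> real"
  have "(measure_pmf.expectation (p \<bind> K) f)\<^sup>2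
      = (measure_pmf.expectation p (\<lambda>x. measure_pmf.expectation (K x) f))\<^sup>2"
    using assms by (subst expectation_bind_finite) (auto intro: finite_subset)
  also have "\<dots> \<le> C * measure_pmf.expectation r (\<lambda>x. (measure_pmf.expectation (K x) f)\<^sup>2)"
    using assms(1) by (simp add: chi_bound_def)
  also have "\<dots> \<le> C * measure_pmf.expectation r
      (\<lambda>x. D * measure_pmf.expectation (L x) (\<lambda>y. (f y)\<^sup>2))"
    using assms by (intro mult_left_mono expectation_mono_finite) (auto simp: chi_bound_def)
  also have "\<dots> = C * D * measure_pmf.expectation (r \<bind> L) (\<lambda>y. (f y)\<^sup>2)"
    using assms by (subst expectation_bind_finite) auto
  finally show "(measure_pmf.expectation (p \<bind> K) f)\<^sup>2
      \<le> C * D * measure_pmf.expectation (r \<bind> L) (\<lambda>y. (f y)\<^sup>2)" .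
qed

text \<open>Cauchy-Schwarz on two points: the constant is twice the sum of the squares of
  \<open>q\<close> and \<open>1 - q\<close>.\<close>

lemma chi_bound_bernoulli_half:
  assumes "0 \<le> q" "q \<le> 1"
  shows "chi_bound (1 + 4 * (1/2 - q)\<^sup>2) (bernoulli_pmf q) (bernoulli_pmf (1/2))"
  unfolding chi_bound_def
proof
  fix f :: "bool \<Rightarrow> real"
  \<comment> \<open>Lagrange's identity: the deficit in Cauchy-Schwarz is a perfect square.\<close>
  have "(1 + 4 * (1/2 - q)\<^sup>2) * ((f True)\<^sup>2 * (1/2) + (f False)\<^sup>2 * (1/2))
      - (f True * q + f False * (1 - q))\<^sup>2 = (f True * (1 - q) - f False * q)\<^sup>2"
    by (simp add: power2_eq_square field_simps)
  then have "(f True * q + f False * (1 - q))\<^sup>2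
      \<le> (1 + 4 * (1/2 - q)\<^sup>2) * ((f True)\<^sup>2 * (1/2) + (f False)\<^sup>2 * (1/2))"
    using zero_le_power2[of "f True * (1 - q) - f False * q"] by linarith
  then show "(measure_pmf.expectation (bernoulli_pmf q) f)\<^sup>2
      \<le> (1 + 4 * (1/2 - q)\<^sup>2) * measure_pmf.expectation (bernoulli_pmf (1/2)) (\<lambda>x. (f x)\<^sup>2)"
    using assms by simp
qed

text \<open>The bound is tested on a small tilt of the constant 1, centred under \<open>r\<close>,
  so a shift of the probability of \<open>E\<close> appears at first order in \<open>s\<close> and
  the second moment moves only at order \<open>s\<^sup>2\<close>. The constant is crude, but it
  vanishes as \<open>C\<close> tends to 1.\<close>

lemma chi_bound_prob_diff:
  assumes "chi_bound C p r" "1 < C" "finite (set_pmf p)" "finite (set_pmf r)"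
  shows "measure_pmf.prob r E - measure_pmf.prob p E \<le> sqrt (C - 1) * (1 + C)"
proof -
  let ?R = "measure_pmf.prob r E" and ?P = "measure_pmf.prob p E"
  let ?I = "indicator E :: _ \<Rightarrow> real"
  note [simp] = integrable_measure_pmf_finite[OF assms(3)] integrable_measure_pmf_finite[OF assms(4)]
  define s where "s = sqrt (C - 1)"
  define f where "f = (\<lambda>x. 1 - s * (?I x - ?R))"
  have s: "0 < s" "s\<^sup>2 = C - 1" using assms(2) by (auto simp: s_def)
  have 1: "measure_pmf.expectation p f = 1 + s * (?R - ?P)"
    by (simp add: f_def algebra_simps)
  have "(f x)\<^sup>2 = (1 + s * ?R)\<^sup>2 - s * (2 * (1 + s * ?R) - s) * ?I x" for x
    by (auto simp: f_def indicator_def power2_eq_square algebra_simps)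
  then have 2: "measure_pmf.expectation r (\<lambda>x. (f x)\<^sup>2)
      = (1 + s * ?R)\<^sup>2 - s * (2 * (1 + s * ?R) - s) * ?R"
    by (simp only: ) simp
  also have "\<dots> = 1 + s\<^sup>2 * (?R * (1 - ?R))"
    by (simp add: power2_eq_square algebra_simps)
  also have "\<dots> \<le> 1 + s\<^sup>2 * 1"
    using mult_mono[of ?R 1 "1 - ?R" 1] by (intro add_left_mono mult_left_mono) auto
  finally have 3: "measure_pmf.expectation r (\<lambda>x. (f x)\<^sup>2) \<le> 1 + s\<^sup>2" by simp
  \<comment> \<open>The discarded term is a square, so the sign of \<open>?R - ?P\<close> is
    irrelevant.\<close>
  have "1 + 2 * s * (?R - ?P) \<le> (1 + s * (?R - ?P))\<^sup>2"
    by (simp add: power2_sum)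
  also have "\<dots> \<le> C * measure_pmf.expectation r (\<lambda>x. (f x)\<^sup>2)"
    using assms(1) 1 unfolding chi_bound_def by metis
  also have "\<dots> \<le> C * (1 + s\<^sup>2)"
    using 3 assms(2) by (intro mult_left_mono) auto
  \<comment> \<open>With \<open>s\<^sup>2 = C - 1\<close> the left side is the square of
    \<open>C\<close>, which exceeds 1 by \<open>(C - 1) * (C + 1)\<close>.\<close>
  also have "\<dots> = 1 + s\<^sup>2 * (1 + C)"
    unfolding s(2) by (simp add: algebra_simps)
  finally have "s * (2 * (?R - ?P)) \<le> s * (s * (1 + C))"
    by (simp add: power2_eq_square algebra_simps)
  then have "2 * (?R - ?P) \<le> s * (1 + C)"
    using s(1) by (simp only: mult_le_cancel_left_pos)
  moreover have "0 \<le> s * (1 + C)" using assms(2) s(1) by simp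
  ultimately have "2 * (?R - ?P) \<le> 2 * (s * (1 + C))" by linarith
  then show ?thesis unfolding s_def by (simp only: mult_le_cancel_left_pos zero_less_numeral)
qed

section \<open>The growth step\<close>

lemma finite_set_parent_pmf:
  assumes "0 < m"
  shows "finite (set_pmf (parent_pmf q m t))"
  using assms by (auto simp: parent_pmf_def)

lemma set_parent_pmf_subset:
  assumes "0 < m"
  shows "set_pmf (parent_pmf q m t) \<subseteq> nodes m"
  using assms by (auto simp: parent_pmf_def nodes_def)

lemma finite_set_bcmrt: "finite (set_pmf (bcmrt q n))"
  by (induction q n rule: bcmrt.induct) (auto simp: finite_set_parent_pmf)

lemma bcmrt_subset_Pow_nodes: "T \<in> set_pmf (bcmrt q n) \<Longrightarrow> T \<subseteq> Pow (nodes n)"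
proof (induction q n arbitrary: T rule: bcmrt.induct)
  case (3 q m)
  then obtain S a b where T: "T = S \<union> {{(Suc (Suc m), Com_A), a}, {(Suc (Suc m), Com_B), b}}"
    and S: "S \<in> set_pmf (bcmrt q (Suc m))"
    and a: "a \<in> set_pmf (parent_pmf q (Suc m) Com_A)"
    and b: "b \<in> set_pmf (parent_pmf q (Suc m) Com_B)"
    by auto
  have "nodes (Suc m) \<subseteq> nodes (Suc (Suc m))" by (auto simp: nodes_def)
  moreover have "S \<subseteq> Pow (nodes (Suc m))" using "3.IH"[OF S] .
  moreover have "a \<in> nodes (Suc m)" "b \<in> nodes (Suc m)"
    using a b set_parent_pmf_subset[of "Suc m" q] by blast+
  moreover have "(Suc (Suc m), t) \<in> nodes (Suc (Suc m))" for t by (simp add: nodes_def)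
  ultimately show ?case unfolding T by blast
qed (auto simp: nodes_def)

text \<open>A fair switch takes both values, so \<open>1/2\<close> dominates every other parameter;
  \<open>chi_bound_bind\<close> asks for this inclusion.\<close>

lemma set_parent_pmf_half:
  assumes "0 \<le> q" "q \<le> 1"
  shows "set_pmf (parent_pmf q m t) \<subseteq> set_pmf (parent_pmf (1/2) m t)"
  by (auto simp: parent_pmf_def)

lemma set_bcmrt_half:
  assumes "0 \<le> q" "q \<le> 1"
  shows "set_pmf (bcmrt q n) \<subseteq> set_pmf (bcmrt (1/2) n)"
  using assms
proof (induction q n rule: bcmrt.induct)
  case (3 q m)
  then show ?case
    unfolding bcmrt.simps set_bind_pmf by (intro UN_mono set_parent_pmf_half subset_refl) auto
qed auto

text \<open>Only the switch depends on \<open>q\<close>; the uniform choice that follows contributes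
  a factor 1.\<close>

lemma chi_bound_parent:
  assumes "0 \<le> q" "q \<le> 1" "0 < m"
  shows "chi_bound (1 + 4 * (1/2 - q)\<^sup>2) (parent_pmf q m t) (parent_pmf (1/2) m t)"
proof -
  have "chi_bound ((1 + 4 * (1/2 - q)\<^sup>2) * 1) (parent_pmf q m t) (parent_pmf (1/2) m t)"
    unfolding parent_pmf_def
    using assms by (intro chi_bound_bind chi_bound_bernoulli_half chi_bound_refl) auto
  then show ?thesis by simp
qed

lemma chi_bound_bcmrt:
  assumes "0 \<le> q" "q \<le> 1"
  shows "chi_bound ((1 + 4 * (1/2 - q)\<^sup>2) ^ (2 * (n - 1))) (bcmrt q n) (bcmrt (1/2) n)"
  using assms
proof (induction q n rule: bcmrt.induct)
  case (3 q m)
  define c where "c = 1 + 4 * (1/2 - q)\<^sup>2"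
  have c: "0 \<le> c" by (simp add: c_def)
  \<comment> \<open>One factor \<open>c\<close> for each of the two new parents, and 1 for the
    deterministic update of the tree.\<close>
  have "chi_bound (c ^ (2 * m) * (c * (c * 1))) (bcmrt q (Suc (Suc m))) (bcmrt (1/2) (Suc (Suc m)))"
    unfolding bcmrt.simps
    using 3 c chi_bound_parent[of q "Suc m"] set_bcmrt_half[of q "Suc m"]
      set_parent_pmf_half[of q "Suc m"]
    by (intro chi_bound_bind) (auto simp: c_def finite_set_parent_pmf finite_set_bcmrt
        simp del: bcmrt.simps intro!: chi_bound_refl)
  then show ?case by (simp add: c_def mult_ac)
qed (auto intro: chi_bound_refl)

section \<open>Counting labels whose two nodes share their parent\<close>

text \<open>The shared parent is recognised as an older common neighbour. Only time-labels and a
  quantifier over both types occur, so hidden types do not matter.\<close>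

definition twins :: "tree \<Rightarrow> nat \<Rightarrow> bool" where
  "twins T k \<longleftrightarrow> (\<exists>a. fst a < k \<and> (\<forall>t. {(k, t), a} \<in> T))"

definition twin_count :: "nat \<Rightarrow> tree \<Rightarrow> nat" where
  "twin_count n T = card {k\<in>{1..n}. twins T k}"

text \<open>The isomorphism permutes the two nodes labelled \<open>k\<close> and sends the shared
  parent to a node with the same label.\<close>

lemma twins_label_iso:
  assumes "(S, T) \<in> label_iso n" "k \<in> {1..n}" "twins S k"
  shows "twins T k"
proof -
  obtain f where f: "S \<subseteq> Pow (nodes n)" "bij_betw f (nodes n) (nodes n)"
    "\<And>v. v \<in> nodes n \<Longrightarrow> fst (f v) = fst v" "(`) f ` S = T"
    using assms(1) by (auto simp: label_iso_def)
  obtain a where a: "fst a < k" "\<And>t. {(k, t), a} \<in> S"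
    using assms(3) unfolding twins_def by blast
  have an: "a \<in> nodes n" using f(1) a(2) by blast
  have "{(k, t), f a} \<in> T" for t
  proof -
    have "(k, t) \<in> nodes n" using assms(2) by (simp add: nodes_def)
    then obtain v where v: "v \<in> nodes n" "f v = (k, t)"
      using f(2) by (metis bij_betw_imp_surj_on imageE)
    then have "v = (k, snd v)" using f(3)[of v] by (metis fst_conv prod.collapse)
    then have "{v, a} \<in> S" using a(2) by metis
    then have "f ` {v, a} \<in> T" using f(4) by blast
    then show ?thesis using v(2) by simp
  qed
  then show ?thesis
    unfolding twins_def using a(1) f(3)[OF an] by (intro exI[of _ "f a"]) auto
qed

lemma twin_count_label_iso:
  assumes "(S, T) \<in> label_iso n"
  shows "twin_count n S = twin_count n T"
proof -
  have "(T, S) \<in> label_iso n"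
    using assms equiv_label_iso[of n] by (meson equivE symE)
  then have "{k\<in>{1..n}. twins S k} = {k\<in>{1..n}. twins T k}"
    using assms twins_label_iso by blast
  then show ?thesis by (simp add: twin_count_def)
qed

text \<open>Both new edges contain the label \<open>Suc m\<close>, so neither can join a node
  labelled \<open>k\<close> to an older one.\<close>

lemma twins_step_old:
  assumes "k \<le> m" "a \<in> nodes m" "b \<in> nodes m"
  shows "twins (T \<union> {{(Suc m, Com_A), a}, {(Suc m, Com_B), b}}) k = twins T k"
proof -
  have "{(k, t), c} \<in> T \<union> {{(Suc m, Com_A), a}, {(Suc m, Com_B), b}} \<longleftrightarrow> {(k, t), c} \<in> T"
    if "fst c < k" for t c
    using assms that by (auto simp: doubleton_eq_iff)
  then show ?thesis by (simp only: twins_def cong: conj_cong)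
qed

lemma all_community: "(\<forall>t. P t) \<longleftrightarrow> P Com_A \<and> P Com_B"
  by (metis community.exhaust)

text \<open>No edge of \<open>T\<close> touches the label \<open>Suc m\<close>, so the new nodes
  have \<open>a\<close> and \<open>b\<close> as their only neighbours.\<close>

lemma twins_step_new:
  assumes "T \<subseteq> Pow (nodes m)" "a \<in> nodes m" "b \<in> nodes m"
  shows "twins (T \<union> {{(Suc m, Com_A), a}, {(Suc m, Com_B), b}}) (Suc m) \<longleftrightarrow> a = b"
proof -
  have "{(Suc m, t), c} \<notin> T" for t c
    using assms(1) by (auto simp: nodes_def)
  then show ?thesis
    using assms(2,3) unfolding twins_def all_community
    by (auto simp: doubleton_eq_iff nodes_def)
qed

lemma twin_count_step:
  assumes "T \<subseteq> Pow (nodes m)" "a \<in> nodes m" "b \<in> nodes m"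
  shows "twin_count (Suc m) (T \<union> {{(Suc m, Com_A), a}, {(Suc m, Com_B), b}})
       = twin_count m T + of_bool (a = b)"
proof -
  let ?T' = "T \<union> {{(Suc m, Com_A), a}, {(Suc m, Com_B), b}}"
  have "{k\<in>{1..Suc m}. twins ?T' k}
      = {k\<in>{1..m}. twins T k} \<union> (if a = b then {Suc m} else {})"
    using twins_step_old[OF _ assms(2,3), of _ T] twins_step_new[OF assms]
    by (auto simp: le_Suc_eq)
  then show ?thesis by (auto simp: twin_count_def)
qed

section \<open>Mean and variance of the twin count\<close>

lemma expectation_parent_pmf:
  assumes "0 \<le> q" "q \<le> 1" "0 < m"
  shows "measure_pmf.expectation (parent_pmf q m t) f
       = q * (\<Sum>k=1..m. f (k, opposite t)) / m + (1 - q) * (\<Sum>k=1..m. f (k, t)) / m"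
proof -
  have "measure_pmf.expectation (pmf_of_set ({1..m} \<times> {u})) f = (\<Sum>k=1..m. f (k, u)) / m" for u
  proof -
    have "{1..m} \<times> {u} = (\<lambda>k. (k, u)) ` {1..m}" by auto
    then have "(\<Sum>x\<in>{1..m} \<times> {u}. f x) = (\<Sum>k=1..m. f (k, u))"
      by (simp add: sum.reindex inj_on_def)
    then show ?thesis using assms(3) by (subst integral_pmf_of_set) auto
  qed
  then show ?thesis
    using assms unfolding parent_pmf_def
    by (subst expectation_bind_finite) (auto simp: add_divide_distrib mult.commute)
qed

text \<open>The parents have a common type when exactly one of the two nodes switches, and then
  agree with probability \<open>1 / m\<close>.\<close>

lemma expectation_same_parent:
  assumes "0 \<le> q" "q \<le> 1" "0 < m"
  shows "measure_pmf.expectation (parent_pmf q m Com_A)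
           (\<lambda>a. measure_pmf.expectation (parent_pmf q m Com_B) (\<lambda>b. of_bool (a = b)))
       = 2 * q * (1 - q) / m"
  using assms by (simp add: expectation_parent_pmf of_bool_def sum.delta field_simps)

text \<open>Here \<open>x\<close> stands for the deviation accumulated so far; the new increment is
  centred, so the cross term vanishes and a Bernoulli variance is added.\<close>

lemma expectation_same_parent_square:
  assumes "0 \<le> q" "q \<le> 1" "0 < m"
  defines "p \<equiv> 2 * q * (1 - q) / m"
  shows "measure_pmf.expectation (parent_pmf q m Com_A)
           (\<lambda>a. measure_pmf.expectation (parent_pmf q m Com_B) (\<lambda>b. (x + of_bool (a = b) - p)\<^sup>2))
       = x\<^sup>2 + p * (1 - p)"
proof -
  note [simp] = integrable_measure_pmf_finite[OF finite_set_parent_pmf[OF assms(3)]]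
  define c where "c = 2 * (x - p) + 1"
  \<comment> \<open>An indicator equals its square, so the expression is affine in it.\<close>
  have "(x + of_bool (a = b) - p)\<^sup>2 = (x - p)\<^sup>2 + c * of_bool (a = b)" for a b :: node
    by (auto simp: c_def power2_eq_square algebra_simps)
  then have "measure_pmf.expectation (parent_pmf q m Com_A)
      (\<lambda>a. measure_pmf.expectation (parent_pmf q m Com_B) (\<lambda>b. (x + of_bool (a = b) - p)\<^sup>2))
      = (x - p)\<^sup>2 + c * p"
    using expectation_same_parent[OF assms(1-3)] by (simp add: p_def)
  also have "\<dots> = x\<^sup>2 + p * (1 - p)"
    by (simp add: c_def power2_eq_square algebra_simps)
  finally show ?thesis .
qed

definition twin_mean :: "real \<Rightarrow> nat \<Rightarrow> real" where
  "twin_mean q n = 2 * q * (1 - q) * harm (n - 1)"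

lemma twin_count_second_moment:
  assumes "0 \<le> q" "q \<le> 1"
  shows "measure_pmf.expectation (bcmrt q n) (\<lambda>T. (twin_count n T - twin_mean q n)\<^sup>2) \<le> twin_mean q n"
  using assms
proof (induction q n rule: bcmrt.induct)
  case (1 q)
  then show ?case by (simp add: twin_count_def twin_mean_def harm_def)
next
  case (2 q)
  \<comment> \<open>The ends of the root edge share the label 1, so neither has an older
    neighbour.\<close>
  have "\<not> twins {{(1, Com_A), (1, Com_B)}} 1"
    by (auto simp: twins_def doubleton_eq_iff all_community)
  then show ?case by (simp add: twin_count_def twin_mean_def harm_def)
next
  case (3 q m)
  define M where "M = Suc m"
  define p where "p = 2 * q * (1 - q) / M"
  define grow where "grow T a b = T \<union> {{(Suc M, Com_A), a}, {(Suc M, Com_B), b}}"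
    for T :: tree and a b :: node
  have mean: "twin_mean q (Suc M) = twin_mean q M + p"
    by (simp add: twin_mean_def p_def M_def harm_Suc field_simps)
  have fin: "finite (set_pmf (parent_pmf q M t))" for t
    by (simp add: finite_set_parent_pmf M_def)
  let ?E = "\<lambda>T. measure_pmf.expectation (parent_pmf q M Com_A)
     (\<lambda>a. measure_pmf.expectation (parent_pmf q M Com_B)
       (\<lambda>b. (twin_count (Suc M) (grow T a b) - twin_mean q (Suc M))\<^sup>2))"
  have inner: "?E T = (twin_count M T - twin_mean q M)\<^sup>2 + p * (1 - p)"
    if "T \<in> set_pmf (bcmrt q M)" for T
  proof -
    let ?x = "twin_count M T - twin_mean q M"
    have "?E T = measure_pmf.expectation (parent_pmf q M Com_A)
     (\<lambda>a. measure_pmf.expectation (parent_pmf q M Com_B) (\<lambda>b. (?x + of_bool (a = b) - p)\<^sup>2))"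
    proof (intro expectation_cong_set_pmf)
      fix a b assume "a \<in> set_pmf (parent_pmf q M Com_A)" "b \<in> set_pmf (parent_pmf q M Com_B)"
      then have "twin_count (Suc M) (grow T a b) = twin_count M T + of_bool (a = b)"
        using set_parent_pmf_subset[of M q] bcmrt_subset_Pow_nodes[OF that]
        unfolding grow_def by (intro twin_count_step) (auto simp: M_def)
      then show "(twin_count (Suc M) (grow T a b) - twin_mean q (Suc M))\<^sup>2
          = (?x + of_bool (a = b) - p)\<^sup>2"
        by (simp add: mean algebra_simps)
    qed
    then show ?thesis
      using expectation_same_parent_square[of q M ?x] 3(2,3) by (simp add: p_def M_def)
  qed
  have bcmrt: "bcmrt q (Suc M) = bcmrt q M \<bind> (\<lambda>T. parent_pmf q M Com_A \<bind>
     (\<lambda>a. parent_pmf q M Com_B \<bind> (\<lambda>b. return_pmf (grow T a b))))"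
    by (simp add: M_def grow_def)
  have "measure_pmf.expectation (bcmrt q (Suc M)) (\<lambda>T. (twin_count (Suc M) T - twin_mean q (Suc M))\<^sup>2)
      = measure_pmf.expectation (bcmrt q M) ?E"
    unfolding bcmrt by (simp add: expectation_bind_finite finite_set_bcmrt fin)
  also have "\<dots> = measure_pmf.expectation (bcmrt q M)
      (\<lambda>T. (twin_count M T - twin_mean q M)\<^sup>2 + p * (1 - p))"
    by (intro expectation_cong_set_pmf inner)
  also have "\<dots> = measure_pmf.expectation (bcmrt q M) (\<lambda>T. (twin_count M T - twin_mean q M)\<^sup>2)
      + p * (1 - p)"
    by (simp add: integrable_measure_pmf_finite finite_set_bcmrt)
  \<comment> \<open>The variance \<open>p * (1 - p)\<close> is at most \<open>p\<close>, the growth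
    of the mean.\<close>
  also have "\<dots> \<le> twin_mean q M + p"
    using 3 by (intro add_mono) (auto simp: M_def algebra_simps)
  finally show ?case by (simp only: mean flip: M_def)
qed

section \<open>The optimal risk\<close>

lemma risk_nonneg: "0 \<le> risk n q r \<phi>"
  by (simp add: risk_def)

lemma bdd_below_risk: "bdd_below (risk n q r ` tests n)"
  by (rule bdd_belowI[of _ 0]) (auto simp: risk_nonneg)

text \<open>The test that always accepts the null hypothesis; it also shows that the infimum ranges
  over a nonempty set.\<close>

lemma const_test: "restrict (\<lambda>_. 0) (time_labelled_trees n) \<in> tests n"
  by (auto simp: tests_def)

lemma optimal_risk_nonneg: "0 \<le> optimal_risk n q r"
  unfolding optimal_risk_def using const_test
  by (intro cINF_greatest) (auto simp: risk_nonneg)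

lemma optimal_risk_le: "\<phi> \<in> tests n \<Longrightarrow> optimal_risk n q r \<le> risk n q r \<phi>"
  unfolding optimal_risk_def by (intro cINF_lower bdd_below_risk)

text \<open>Pulls errors back to typed trees, where both the moment and the chi-square bounds are
  available.\<close>

lemma risk_bcmrt:
  "risk n q r \<phi> = 1/2 * (measure_pmf.prob (bcmrt q n) {T. \<phi> (label_iso n `` {T}) = 1}
     + measure_pmf.prob (bcmrt r n) {T. \<phi> (label_iso n `` {T}) = 0})"
  by (simp add: risk_def time_labelled_bcmrt_def vimage_def)

lemma class_in_time_labelled_trees:
  assumes "0 \<le> q" "q \<le> 1" "T \<in> set_pmf (bcmrt q n)"
  shows "label_iso n `` {T} \<in> time_labelled_trees n"
  using assms by (auto simp: time_labelled_trees_def time_labelled_bcmrt_def)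

lemma optimal_risk_le_half:
  assumes "0 \<le> q" "q \<le> 1"
  shows "optimal_risk n q r \<le> 1/2"
proof -
  let ?\<phi> = "restrict (\<lambda>_. 0) (time_labelled_trees n) :: tree set \<Rightarrow> nat"
  have "measure_pmf.prob (bcmrt q n) {T. ?\<phi> (label_iso n `` {T}) = 1} = 0"
    using class_in_time_labelled_trees[OF assms] by (auto simp: measure_pmf_zero_iff)
  then have "risk n q r ?\<phi> \<le> 1/2" by (simp add: risk_bcmrt)
  then show ?thesis using optimal_risk_le[OF const_test] order_trans by blast
qed

text \<open>Twice the risk is at least 1 minus the difference of the two probabilities of rejection,
  and rejection is an event on typed trees.\<close>

lemma optimal_risk_ge:
  fixes n :: nat
  assumes q: "0 \<le> q" "q < 1/2" and n: "2 \<le> n"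
  defines "C \<equiv> (1 + 4 * (1/2 - q)\<^sup>2) ^ (2 * (n - 1))"
  shows "1/2 * (1 - sqrt (C - 1) * (1 + C)) \<le> optimal_risk n q (1/2)"
  unfolding optimal_risk_def
proof (rule cINF_greatest)
  show "tests n \<noteq> {}" using const_test by blast
next
  fix \<phi> assume \<phi>: "\<phi> \<in> tests n"
  let ?E = "\<lambda>i. {T. \<phi> (label_iso n `` {T}) = i}"
  have C: "1 < C" unfolding C_def using q n by (intro one_less_power) auto
  \<comment> \<open>A test is two-valued only on classes that can occur, so the inclusion holds
    almost surely.\<close>
  have "measure_pmf.prob (bcmrt (1/2) n) (- ?E 0) \<le> measure_pmf.prob (bcmrt (1/2) n) (?E 1)"
  proof (rule measure_pmf.finite_measure_mono_AE)
    show "AE T in bcmrt (1/2) n. T \<in> - ?E 0 \<longrightarrow> T \<in> ?E 1"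
      using \<phi> class_in_time_labelled_trees[of "1/2" _ n]
      by (fastforce simp: AE_measure_pmf_iff tests_def PiE_iff)
  qed auto
  then have "1 - measure_pmf.prob (bcmrt (1/2) n) (?E 0) \<le> measure_pmf.prob (bcmrt (1/2) n) (?E 1)"
    using measure_pmf.prob_compl[of "?E 0" "bcmrt (1/2) n"] by (simp add: Compl_eq_Diff_UNIV)
  moreover have "measure_pmf.prob (bcmrt (1/2) n) (?E 1) - measure_pmf.prob (bcmrt q n) (?E 1)
      \<le> sqrt (C - 1) * (1 + C)"
    using q chi_bound_bcmrt[of q n] C
    by (intro chi_bound_prob_diff) (auto simp: C_def finite_set_bcmrt)
  ultimately show "1/2 * (1 - sqrt (C - 1) * (1 + C)) \<le> risk n q (1/2) \<phi>"
    unfolding risk_bcmrt by (intro mult_left_mono) linarith+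
qed

section \<open>The risk of the twin-count test\<close>

text \<open>Chebyshev's inequality for an arbitrary event, so that it serves both tails.\<close>

lemma twin_count_deviation:
  assumes "0 \<le> q" "q \<le> 1" "0 < d"
    and "\<And>T. T \<in> set_pmf (bcmrt q n) \<Longrightarrow> T \<in> E \<Longrightarrow> d \<le> \<bar>twin_count n T - twin_mean q n\<bar>"
  shows "measure_pmf.prob (bcmrt q n) E \<le> twin_mean q n / d\<^sup>2"
proof -
  have "measure_pmf.prob (bcmrt q n) E
      \<le> measure_pmf.expectation (bcmrt q n) (\<lambda>T. (twin_count n T - twin_mean q n)\<^sup>2 / d\<^sup>2)"
  proof (rule prob_le_expectation)
    fix T assume "T \<in> set_pmf (bcmrt q n)" "T \<in> E"
    then have "\<bar>d\<bar> \<le> \<bar>twin_count n T - twin_mean q n\<bar>" using assms by auto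
    then have "d\<^sup>2 \<le> (twin_count n T - twin_mean q n)\<^sup>2" by (simp only: abs_le_square_iff)
    then show "1 \<le> (twin_count n T - twin_mean q n)\<^sup>2 / d\<^sup>2" using assms(3) by simp
  qed (auto simp: finite_set_bcmrt)
  also have "\<dots> \<le> twin_mean q n / d\<^sup>2"
    using twin_count_second_moment[OF assms(1,2), of n] by (simp add: divide_right_mono)
  finally show ?thesis .
qed

lemma optimal_risk_twin_bound:
  assumes q: "0 \<le> q" "q < r" "r \<le> 1/2" and n: "2 \<le> n"
  shows "optimal_risk n q r \<le> 2 * (1 / (((r - q)\<^sup>2 * (1 - q - r)\<^sup>2) / (r / ln n)))"
proof -
  define H :: real where "H = harm (n - 1)"
  have H: "ln n \<le> H" "0 < ln n" using n ln_le_harm[of "n - 1"] by (auto simp: H_def)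
  define \<delta> where "\<delta> = (r - q) * (1 - q - r)"
  have \<delta>: "0 < \<delta>" using q by (auto simp: \<delta>_def)
  have mean: "twin_mean r n - twin_mean q n = 2 * (\<delta> * H)"
    by (simp add: twin_mean_def \<delta>_def H_def algebra_simps)
  define d where "d = \<delta> * H"
  have d: "0 < d" using \<delta> H by (simp add: d_def)
  \<comment> \<open>The means differ by \<open>2 * d\<close>, so this is their midpoint and either
    error forces a deviation of at least \<open>d\<close>.\<close>
  define \<theta> where "\<theta> = twin_mean q n + d"
  \<comment> \<open>Only the isomorphism class is observed; the count is read off any
    representative, as it is constant on the class.\<close>
  define \<phi> where "\<phi> = restrict (\<lambda>\<tau>. if \<theta> < twin_count n (SOME T. T \<in> \<tau>) then 1 else 0 :: nat)
    (time_labelled_trees n)"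
  have \<phi>: "\<phi> (label_iso n `` {T}) = (if \<theta> < twin_count n T then 1 else 0)"
    if "0 \<le> s" "s \<le> 1" "T \<in> set_pmf (bcmrt s n)" for s T
  proof -
    have "(T, T) \<in> label_iso n"
      using bcmrt_subset_Pow_nodes[OF that(3)] equiv_label_iso[of n]
      by (meson PowI equivE refl_onD)
    then have "(T, SOME S. S \<in> label_iso n `` {T}) \<in> label_iso n"
      using someI[of "\<lambda>S. S \<in> label_iso n `` {T}" T] by simp
    then show ?thesis
      using class_in_time_labelled_trees[OF that] twin_count_label_iso by (simp add: \<phi>_def)
  qed
  have "measure_pmf.prob (bcmrt q n) {T. \<phi> (label_iso n `` {T}) = 1} \<le> twin_mean q n / d\<^sup>2"
    using q d \<phi>[of q] by (intro twin_count_deviation) (auto simp: \<theta>_def split: if_splits)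
  moreover have "measure_pmf.prob (bcmrt r n) {T. \<phi> (label_iso n `` {T}) = 0} \<le> twin_mean r n / d\<^sup>2"
    using q d \<phi>[of r] mean
    by (intro twin_count_deviation) (auto simp: \<theta>_def d_def split: if_splits)
  ultimately have "risk n q r \<phi> \<le> 1/2 * (twin_mean q n / d\<^sup>2 + twin_mean r n / d\<^sup>2)"
    unfolding risk_bcmrt by (intro mult_left_mono add_mono) auto
  also have "\<dots> \<le> 1/2 * (twin_mean r n / d\<^sup>2 + twin_mean r n / d\<^sup>2)"
    using mean d by (intro mult_left_mono add_mono divide_right_mono) (auto simp: d_def)
  also have "\<dots> = twin_mean r n / d\<^sup>2" by simp
  also have "\<dots> \<le> 2 * r * H / d\<^sup>2"
    unfolding twin_mean_def H_def[symmetric] using q H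
    by (intro divide_right_mono mult_right_mono) (auto simp: mult_left_le)
  \<comment> \<open>The mean is linear and \<open>d\<^sup>2\<close> quadratic in \<open>H\<close>,
    so one factor \<open>H\<close> survives and is bounded below by \<open>ln n\<close>.\<close>
  also have "\<dots> = 2 * r / \<delta>\<^sup>2 / H"
    using H \<delta> by (simp add: d_def power2_eq_square field_simps)
  also have "\<dots> \<le> 2 * r / \<delta>\<^sup>2 / ln n"
    using H q by (intro divide_left_mono) auto
  also have "\<dots> = 2 * (1 / (((r - q)\<^sup>2 * (1 - q - r)\<^sup>2) / (r / ln n)))"
    by (simp add: \<delta>_def power_mult_distrib)
  finally have "risk n q r \<phi> \<le> 2 * (1 / (((r - q)\<^sup>2 * (1 - q - r)\<^sup>2) / (r / ln n)))" .
  moreover have "\<phi> \<in> tests n" by (auto simp: \<phi>_def tests_def)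
  ultimately show ?thesis using optimal_risk_le order_trans by blast
qed

section \<open>Passage to the limit\<close>

lemma optimal_risk_tendsto_0:
  assumes q: "\<forall>n\<ge>1. 0 \<le> q n \<and> q n < r n \<and> r n \<le> 1/2"
    and lim: "filterlim (\<lambda>n. ((r n - q n)\<^sup>2 * (1 - q n - r n)\<^sup>2) / (r n / ln (real n))) at_top sequentially"
  shows "(\<lambda>n. optimal_risk n (q n) (r n)) \<longlonglongrightarrow> 0"
proof (rule tendsto_sandwich[OF _ _ tendsto_const])
  show "(\<lambda>n. 2 * (1 / (((r n - q n)\<^sup>2 * (1 - q n - r n)\<^sup>2) / (r n / ln (real n))))) \<longlonglongrightarrow> 0"
    using tendsto_mult_right_zero[OF tendsto_divide_0[OF tendsto_const
        filterlim_at_top_imp_at_infinity[OF lim]]] .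
  show "\<forall>\<^sub>F n in sequentially. optimal_risk n (q n) (r n)
      \<le> 2 * (1 / (((r n - q n)\<^sup>2 * (1 - q n - r n)\<^sup>2) / (r n / ln (real n))))"
    using eventually_ge_at_top[of 2] by eventually_elim (use q optimal_risk_twin_bound in auto)
qed (simp add: optimal_risk_nonneg)

lemma optimal_risk_tendsto_half:
  assumes q: "\<forall>n\<ge>1. 0 \<le> q n \<and> q n < 1/2"
    and lim: "(\<lambda>n. (1/2 - q n) / (1 / sqrt (real n))) \<longlonglongrightarrow> 0"
  shows "(\<lambda>n. optimal_risk n (q n) (1/2)) \<longlonglongrightarrow> 1/2"
proof (rule tendsto_sandwich[OF _ _ _ tendsto_const])
  define C where "C n = (1 + 4 * (1/2 - q n)\<^sup>2) ^ (2 * (n - 1))" for n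
  define x where "x n = (1/2 - q n) / (1 / sqrt (real n))" for n
  have "C \<longlonglongrightarrow> 1"
  proof (rule tendsto_sandwich[OF _ _ tendsto_const])
    have "(\<lambda>n. exp (8 * (x n)\<^sup>2)) \<longlonglongrightarrow> exp (8 * 0\<^sup>2)"
      using lim unfolding x_def by (intro tendsto_intros)
    then show "(\<lambda>n. exp (8 * (x n)\<^sup>2)) \<longlonglongrightarrow> 1" by simp
    show "\<forall>\<^sub>F n in sequentially. 1 \<le> C n"
      by (intro always_eventually allI) (simp add: C_def one_le_power)
    \<comment> \<open>From \<open>1 + u \<le> exp u\<close>, with the exponent
      \<open>2 * (n - 1)\<close> enlarged to \<open>2 * n\<close>; the factor \<open>n\<close> is
      absorbed into \<open>(x n)\<^sup>2\<close>.\<close>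
    have "C n \<le> exp (8 * (x n)\<^sup>2)" for n
    proof -
      have "C n \<le> exp (4 * (1/2 - q n)\<^sup>2) ^ (2 * (n - 1))"
        unfolding C_def by (intro power_mono exp_ge_add_one_self) simp
      also have "\<dots> \<le> exp (4 * (1/2 - q n)\<^sup>2) ^ (2 * n)"
        by (intro power_increasing) auto
      also have "\<dots> = exp (8 * (x n)\<^sup>2)"
        by (simp add: x_def exp_of_nat_mult[symmetric] power_mult_distrib)
      finally show ?thesis .
    qed
    then show "\<forall>\<^sub>F n in sequentially. C n \<le> exp (8 * (x n)\<^sup>2)" by simp
  qed
  then have "(\<lambda>n. 1/2 * (1 - sqrt (C n - 1) * (1 + C n))) \<longlonglongrightarrow> 1/2 * (1 - sqrt (1 - 1) * (1 + 1))"
    by (intro tendsto_intros)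
  then show "(\<lambda>n. 1/2 * (1 - sqrt (C n - 1) * (1 + C n))) \<longlonglongrightarrow> 1/2" by simp
  show "\<forall>\<^sub>F n in sequentially. 1/2 * (1 - sqrt (C n - 1) * (1 + C n)) \<le> optimal_risk n (q n) (1/2)"
    using eventually_ge_at_top[of 2]
    by eventually_elim (unfold C_def, rule optimal_risk_ge, use q in auto)
  show "\<forall>\<^sub>F n in sequentially. optimal_risk n (q n) (1/2) \<le> 1/2"
    using eventually_ge_at_top[of 1]
  proof eventually_elim
    case (elim n)
    then have "0 \<le> q n \<and> q n < 1/2" using q by blast
    then show ?case by (intro optimal_risk_le_half) auto
  qed
qed

theorem theorem4:
  shows "(\<forall>q\<^sub>0 q\<^sub>1 :: nat \<Rightarrow> real.
            (\<forall>n\<ge>1. 0 \<le> q\<^sub>0 n \<and> q\<^sub>0 n < q\<^sub>1 n \<and> q\<^sub>1 n \<le> 1/2) \<longrightarrow>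
            filterlim (\<lambda>n. ((q\<^sub>1 n - q\<^sub>0 n)\<^sup>2 * (1 - q\<^sub>0 n - q\<^sub>1 n)\<^sup>2) / (q\<^sub>1 n / ln (real n)))
              at_top sequentially \<longrightarrow>
            (\<lambda>n. optimal_risk n (q\<^sub>0 n) (q\<^sub>1 n)) \<longlonglongrightarrow> 0)
       \<and> (\<forall>q\<^sub>0 :: nat \<Rightarrow> real.
            (\<forall>n\<ge>1. 0 \<le> q\<^sub>0 n \<and> q\<^sub>0 n < 1/2) \<longrightarrow>
            filterlim (\<lambda>n. (1/2 - q\<^sub>0 n) / (1 / ln (real n) powr (1/4)))
              at_top sequentially \<longrightarrow>
            (\<lambda>n. optimal_risk n (q\<^sub>0 n) (1/2)) \<longlonglongrightarrow> 0)
       \<and> (\<forall>q\<^sub>0 :: nat \<Rightarrow> real.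
            (\<forall>n\<ge>1. 0 \<le> q\<^sub>0 n \<and> q\<^sub>0 n < 1/2) \<longrightarrow>
            (\<lambda>n. (1/2 - q\<^sub>0 n) / (1 / sqrt (real n))) \<longlonglongrightarrow> 0 \<longrightarrow>
            (\<lambda>n. optimal_risk n (q\<^sub>0 n) (1/2)) \<longlonglongrightarrow> 1/2)"
proof (intro conjI allI impI)
  fix q\<^sub>0 :: "nat \<Rightarrow> real"
  assume q: "\<forall>n\<ge>1. 0 \<le> q\<^sub>0 n \<and> q\<^sub>0 n < 1/2"
  define y where "y n = (1/2 - q\<^sub>0 n) / (1 / ln (real n) powr (1/4))" for n
  assume "filterlim (\<lambda>n. (1/2 - q\<^sub>0 n) / (1 / ln (real n) powr (1/4))) at_top sequentially"
  then have "filterlim (\<lambda>n. (y n) ^ 4) at_top sequentially"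
    unfolding y_def[symmetric] by (intro filterlim_pow_at_top) auto
  then have lim: "filterlim (\<lambda>n. 2 * (y n) ^ 4) at_top sequentially"
    by (intro filterlim_tendsto_pos_mult_at_top[OF tendsto_const]) auto
  \<comment> \<open>At \<open>1/2\<close> both differences in the general condition equal
    \<open>1/2 - q\<^sub>0 n\<close>, which gives a fourth power and explains the exponent
    \<open>1/4\<close> of the logarithm.\<close>
  have eq: "\<forall>\<^sub>F n in sequentially. 2 * (y n) ^ 4
      = ((1/2 - q\<^sub>0 n)\<^sup>2 * (1 - q\<^sub>0 n - 1/2)\<^sup>2) / (1/2 / ln (real n))"
    using eventually_ge_at_top[of 2]
  proof eventually_elim
    case (elim n)
    then have "0 < ln (real n)" by simp
    then have "(ln (real n) powr (1/4)) ^ 4 = ln (real n)"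
      by (simp add: powr_power)
    then have "2 * (y n) ^ 4 = 2 * (1/2 - q\<^sub>0 n) ^ 4 * ln (real n)"
      by (simp add: y_def power_mult_distrib)
    moreover have "(1/2 - q\<^sub>0 n)\<^sup>2 * (1 - q\<^sub>0 n - 1/2)\<^sup>2 = (1/2 - q\<^sub>0 n) ^ 4"
      by (simp add: power_add[symmetric])
    ultimately show ?case by simp
  qed
  have "filterlim (\<lambda>n. ((1/2 - q\<^sub>0 n)\<^sup>2 * (1 - q\<^sub>0 n - 1/2)\<^sup>2) / (1/2 / ln (real n)))
      at_top sequentially"
    using lim unfolding filterlim_cong[OF refl refl eq] .
  with q show "(\<lambda>n. optimal_risk n (q\<^sub>0 n) (1/2)) \<longlonglongrightarrow> 0"
    by (intro optimal_risk_tendsto_0) auto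
qed (use optimal_risk_tendsto_0 optimal_risk_tendsto_half in auto)

end
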